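(* Let $v=(a,b,p,q,r)^T\in P$ and assume $a+b-p>0$ and $r-a>0$. Let $$M=\begin{pmatrix}-1&0&0&0&1\\1&1&-1&0&0\\0&1&-1&-1&1\\0&1&0&0&0\\0&1&0&-1&1\end{pmatrix},\qquad \Pi=\begin{pmatrix}1&1&-1&0&0\\-1&0&0&0&1\end{pmatrix},$$ so that $Mv=(r-a,\;a+b-p,\;r+b-p-q,\;b,\;r+b-q)^T$ and $\Pi v=(a+b-p,\;r-a)^T$. Then $Mv\in P$, and if $X\sim BH(v)$ and $W\sim\beta^{(2)}_{\Pi v}$ are independent, then $$\frac{1}{1+XW}\sim BH(Mv).$$
   Context: $\mathbb{N}=\{0,1,2,\ldots\}$. $_2F_1(p,q;r;x)=\sum_{n\ge0}\frac{(p)_n(q)_n}{n!(r)_n}x^n$ with $(t)_0=1$, $(t)_{n+1}=(t+n)(t)_n$, for real $p,q,r$ with $r\notin-\mathbb{N}$ and $0<x<1$. $P$ is the set of $(a,b,p,q,r)\in\mathbb{R}^5$ such that $r\notin-\mathbb{N}$, $_2F_1(p,q;r;x)>0$ for all $x\in(0,1)$, $a>0$, $b>0$ and $r+b-p-q>0$. For $v=(a,b,p,q,r)^T\in P$, the beta-hypergeometric distribution $BH(v)=BH(a,b,p,q,r)$ is the probability on $(0,1)$ with density proportional to $x^{a-1}(1-x)^{b-1}\,_2F_1(p,q;r;x)$. For $c,d>0$, $\beta^{(2)}_{c,d}$ (beta distribution of the second kind) is the probability on $(0,\infty)$ with density $\frac{1}{B(c,d)}\frac{w^{c-1}}{(1+w)^{c+d}}$;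 $\beta^{(2)}_{\Pi v}$ means $\beta^{(2)}_{c,d}$ with $(c,d)^T=\Pi v$. *)

theory Defs
  imports "HOL-Probability.Probability"
begin

definition hyp2F1 :: "real \<Rightarrow> real \<Rightarrow> real \<Rightarrow> real \<Rightarrow> real" where
  "hyp2F1 p q r x =
     (\<Sum>n. pochhammer p n * pochhammer q n / (fact n * pochhammer r n) * x ^ n)"

text \<open>
  A parameter vector \<open>v = (a, b, p, q, r)\<close> is an element of \<open>real^5\<close> with
  \<open>a = v $ 1\<close>, \<open>b = v $ 2\<close>, \<open>p = v $ 3\<close>, \<open>q = v $ 4\<close>, \<open>r = v $ 5\<close>.
  In the index type \<open>5\<close> arithmetic is modulo 5, so the index \<open>5\<close> coincides with \<open>0\<close>;
  the five indices are still distinct.  The set \<open>\<int>\<^sub>\<le>\<^sub>0\<close> of excluded values of \<open>r\<close>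
  contains \<open>0\<close>.
\<close>

definition BH_params :: "(real^5) set" where
  "BH_params = {v.
     v $ 5 \<notin> \<int>\<^sub>\<le>\<^sub>0 \<and>
     (\<forall>x\<in>{0<..<1}. hyp2F1 (v $ 3) (v $ 4) (v $ 5) x > 0) \<and>
     v $ 1 > 0 \<and> v $ 2 > 0 \<and>
     v $ 5 + v $ 2 - v $ 3 - v $ 4 > 0}"

definition BH_kernel :: "real^5 \<Rightarrow> real \<Rightarrow> real" where
  "BH_kernel v x =
     x powr (v $ 1 - 1) * (1 - x) powr (v $ 2 - 1) *
     hyp2F1 (v $ 3) (v $ 4) (v $ 5) x * indicator {0<..<1} x"

text \<open>
  For \<open>v \<in> BH_params\<close> the kernel is integrable with positive integral; for other \<open>v\<close>
  the value of the following constant is meaningless.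
\<close>

definition BH_density :: "real^5 \<Rightarrow> real \<Rightarrow> real" where
  "BH_density v x = BH_kernel v x / (\<integral>y. BH_kernel v y \<partial>lborel)"

definition beta2_density :: "real \<Rightarrow> real \<Rightarrow> real \<Rightarrow> real" where
  "beta2_density c d w =
     1 / Beta c d * (w powr (c - 1) / (1 + w) powr (c + d)) * indicator {0<..} w"

definition M_mat :: "real^5^5" where
  "M_mat = vector
    [vector [-1, 0,  0,  0, 1],
     vector [ 1, 1, -1,  0, 0],
     vector [ 0, 1, -1, -1, 1],
     vector [ 0, 1,  0,  0, 0],
     vector [ 0, 1,  0, -1, 1]]"

definition Pi_mat :: "real^5^2" where
  "Pi_mat = vector
    [vector [ 1, 1, -1, 0, 0],
     vector [-1, 0,  0, 0, 1]]"

end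

theory Submission
  imports Defs "HOL-Real_Asymp.Real_Asymp"
begin

text \<open>
  Given \<open>X = x\<close>, the variable \<open>1 / (1 + x W)\<close> has an explicit density, and integrating it against
  the density of \<open>X\<close> leaves, up to the factors \<open>y powr (r - a - 1)\<close> and
  \<open>(1 - y) powr (a + b - p - 1)\<close>, the integral of
  \<open>x powr (r - 1) * (1 - x) powr (b - 1) * F(p, q; r; x) * (1 - y (1 - x)) powr - (r + b - p)\<close>.
  Expanding the last factor in powers of \<open>y\<close> reduces this to the integrals \<open>J c\<close> of
  \<open>x powr (r - 1) * (1 - x) powr (c - 1) * F(p, q; r; x)\<close> for \<open>c = b, b + 1, \<dots>\<close>.  Termwise
  \<open>J c = Beta r c * F(p, q; r + c; 1)\<close>, and a telescoping contiguous relation for \<open>F\<close> at \<open>1\<close>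
  (in place of Gauss's summation formula) gives
  \<open>(r + c - p) (r + c - q) J (c + 1) = c (r + c - p - q) J c\<close>.  Hence the expansion is a multiple of
  \<open>F(r + b - p - q, b; r + b - q; y)\<close>.  As \<open>J b\<close> and \<open>J (b + 1)\<close> are positive, the recurrence
  also forces \<open>r + b - q > 0\<close>, so that all coefficients of this series are positive.
\<close>

subsection \<open>The hypergeometric series and its value at 1\<close>

definition hyp_coeff :: "real \<Rightarrow> real \<Rightarrow> real \<Rightarrow> nat \<Rightarrow> real" where
  "hyp_coeff p q r n = pochhammer p n * pochhammer q n / (fact n * pochhammer r n)"

lemma hyp2F1_altdef: "hyp2F1 p q r x = (\<Sum>n. hyp_coeff p q r n * x ^ n)"
  by (simp add: hyp2F1_def hyp_coeff_def)

lemma pochhammer_nonzero: "x > 0 \<Longrightarrow> pochhammer x n \<noteq> (0::real)"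
  using pochhammer_pos[of x n] by linarith

lemma hyp_coeff_pos: "p > 0 \<Longrightarrow> q > 0 \<Longrightarrow> r > 0 \<Longrightarrow> hyp_coeff p q r n > 0"
  by (simp add: hyp_coeff_def pochhammer_pos)

section \<open>Recurrence and growth of the coefficients\<close>

lemma hyp_coeff_Suc:
  assumes "r > 0"
  shows "Suc n * hyp_coeff p q r (Suc n) = (p + n) * (q + n) / (r + n) * hyp_coeff p q r n"
  using assms pochhammer_nonzero[of r n]
  by (simp add: hyp_coeff_def pochhammer_Suc divide_simps del: of_nat_Suc)

text \<open>For \<open>n > 0\<close> the sequence is exactly the quotient of the products
  \<open>rGamma_series\<close> for \<open>p\<close>, \<open>q\<close> and \<open>r\<close>; the
  factor \<open>Suc n\<close> reduces \<open>fact (Suc n)\<close> to \<open>fact n\<close>. Since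
  \<open>rGamma\<close> is entire, nonpositive integers \<open>p\<close> and \<open>q\<close> are
  covered too; the limit is then 0.\<close>

lemma hyp_coeff_asymp:
  assumes "r > 0"
  shows "(\<lambda>n. Suc n * hyp_coeff p q r (Suc n) / real n powr (p + q - r))
           \<longlonglongrightarrow> rGamma p * rGamma q / rGamma r"
proof -
  have "rGamma r \<noteq> 0"
    using assms by (auto simp: rGamma_eq_zero_iff elim!: nonpos_Ints_cases')
  then have "(\<lambda>n. rGamma_series p n * rGamma_series q n / rGamma_series r n)
          \<longlonglongrightarrow> rGamma p * rGamma q / rGamma r"
    by (intro tendsto_intros)
  moreover have "\<forall>\<^sub>F n in sequentially. rGamma_series p n * rGamma_series q n / rGamma_series r n
      = Suc n * hyp_coeff p q r (Suc n) / real n powr (p + q - r)"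
    using eventually_gt_at_top[of 0]
  proof eventually_elim
    case (elim n)
    have e: "exp (z * of_real (ln (real n))) = real n powr z" for z
      using elim by (simp add: powr_def)
    have "real n powr (p + q - r) = real n powr p * real n powr q / real n powr r"
      by (simp add: powr_add powr_diff)
    then show ?case
      using elim assms pochhammer_nonzero[of r "Suc n"]
      unfolding rGamma_series_def e hyp_coeff_def
      by (simp add: divide_simps mult.commute del: of_nat_Suc)
  qed
  ultimately show ?thesis
    by (rule Lim_transform_eventually)
qed

lemma hyp_coeff_bigo:
  assumes "r > 0"
  shows "(\<lambda>n. Suc n * hyp_coeff p q r (Suc n)) \<in> O(\<lambda>n. real n powr (p + q - r))"
proof (rule bigoI_tendsto[OF hyp_coeff_asymp[OF assms]])
  show "\<forall>\<^sub>F x in sequentially. real x powr (p + q - r) \<noteq> 0"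
    using eventually_gt_at_top[of 0] by eventually_elim auto
qed

lemma Suc_inverse_bigo: "(\<lambda>n. 1 / real (Suc n)) \<in> O(\<lambda>n. real n powr - 1)"
  by real_asymp

text \<open>The coefficients are of order at most \<open>n powr (p + q - r - 1)\<close>, with an
  exponent below -1.\<close>

lemma summable_hyp_coeff:
  assumes "r > 0" "p + q < r"
  shows "summable (\<lambda>n. norm (hyp_coeff p q r n))"
proof -
  have "(\<lambda>n. 1 / real (Suc n) * (Suc n * hyp_coeff p q r (Suc n)))
          \<in> O(\<lambda>n. real n powr - 1 * real n powr (p + q - r))"
    by (rule landau_o.big.mult[OF Suc_inverse_bigo hyp_coeff_bigo[OF assms(1)]])
  also have "(\<lambda>n. real n powr - 1 * real n powr (p + q - r)) = (\<lambda>n. real n powr (p + q - r - 1))"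
    by (subst powr_add[symmetric]) (simp add: algebra_simps)
  also have "(\<lambda>n. 1 / real (Suc n) * (Suc n * hyp_coeff p q r (Suc n))) = (\<lambda>n. hyp_coeff p q r (Suc n))"
    by (auto simp del: of_nat_Suc)
  finally have "(\<lambda>n. norm (hyp_coeff p q r (Suc n))) \<in> O(\<lambda>n. real n powr (p + q - r - 1))"
    by simp
  moreover have "summable (\<lambda>n. norm (real n powr (p + q - r - 1)))"
    using assms by (simp add: summable_real_powr_iff)
  ultimately have "summable (\<lambda>n. norm (hyp_coeff p q r (Suc n)))"
    by (rule summable_comparison_test_bigo[rotated])
  then show ?thesis
    by (subst (asm) summable_Suc_iff)
qed

text \<open>Disposes of the boundary term of the telescoping sum in
  \<open>hyp2F1_at_1_contiguous\<close>.\<close>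

lemma hyp_coeff_times_n_tendsto_0:
  assumes "r > 0" "p + q < r"
  shows "(\<lambda>n. n * hyp_coeff p q r n) \<longlonglongrightarrow> 0"
proof -
  have "(\<lambda>n. real n powr (p + q - r)) \<longlonglongrightarrow> 0"
    using assms by real_asymp
  then have "(\<lambda>n. real n powr (p + q - r)) \<in> o(\<lambda>_. 1)"
    by (intro smalloI_tendsto) auto
  then have "(\<lambda>n. Suc n * hyp_coeff p q r (Suc n)) \<in> o(\<lambda>_. 1)"
    by (rule landau_o.big_small_trans[OF hyp_coeff_bigo[OF assms(1), of p q]])
  then have "(\<lambda>n. Suc n * hyp_coeff p q r (Suc n)) \<longlonglongrightarrow> 0"
    using smalloD_tendsto by fastforce
  then show ?thesis
    by (subst (asm) filterlim_sequentially_Suc)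
qed

lemma summable_hyp2F1:
  assumes "r > 0" "\<bar>x\<bar> < 1"
  shows "summable (\<lambda>n. norm (hyp_coeff p q r n * x ^ n))"
proof -
  \<comment> \<open>The ratios of consecutive terms tend in absolute value to that of
    \<open>x\<close>, so any \<open>c\<close> strictly between it and 1 serves in the ratio
    test.\<close>
  obtain c where c: "\<bar>x\<bar> < c" "c < 1"
    using assms dense by blast
  have "(\<lambda>n. (p + real n) * (q + real n) / ((r + real n) * real (Suc n))) \<longlonglongrightarrow> 1"
    by real_asymp
  then have "(\<lambda>n. \<bar>(p + real n) * (q + real n) / ((r + real n) * real (Suc n)) * x\<bar>) \<longlonglongrightarrow> \<bar>1 * x\<bar>"
    by (intro tendsto_intros)
  then have "\<forall>\<^sub>F n in sequentially. \<bar>(p + real n) * (q + real n) / ((r + real n) * real (Suc n)) * x\<bar> < c"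
    using c by (intro order_tendstoD) auto
  then obtain N where N: "\<bar>(p + real n) * (q + real n) / ((r + real n) * real (Suc n)) * x\<bar> < c" if "n \<ge> N" for n
    by (auto simp: eventually_sequentially)
  show ?thesis
  proof (rule summable_ratio_test[of c N], fact)
    fix n assume "n \<ge> N"
    have "hyp_coeff p q r (Suc n) = (p + n) * (q + n) / ((r + n) * Suc n) * hyp_coeff p q r n"
      using hyp_coeff_Suc[OF assms(1), of n p q]
      by (metis divide_divide_eq_left nonzero_mult_div_cancel_left of_nat_neq_0 times_divide_eq_left)
    then have "hyp_coeff p q r (Suc n) * x ^ Suc n
        = ((p + n) * (q + n) / ((r + n) * Suc n) * x) * (hyp_coeff p q r n * x ^ n)"
      by simp
    then have "norm (hyp_coeff p q r (Suc n) * x ^ Suc n)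
        = \<bar>(p + n) * (q + n) / ((r + n) * Suc n) * x\<bar> * norm (hyp_coeff p q r n * x ^ n)"
      by (simp only: real_norm_def abs_mult)
    also have "\<dots> \<le> c * norm (hyp_coeff p q r n * x ^ n)"
      using N[OF \<open>n \<ge> N\<close>] by (intro mult_right_mono) auto
    finally show "norm (norm (hyp_coeff p q r (Suc n) * x ^ Suc n)) \<le> c * norm (norm (hyp_coeff p q r n * x ^ n))"
      by simp
  qed
qed

section \<open>The contiguous relation at 1\<close>

lemma hyp_coeff_plus1:
  assumes "r > 0"
  shows "hyp_coeff p q (r + 1) n = r / (r + n) * hyp_coeff p q r n"
proof -
  have "r * pochhammer (r + 1) n = pochhammer r n * (r + n)"
    by (metis pochhammer_Suc pochhammer_rec)
  then have "pochhammer (r + 1) n = pochhammer r n * (r + n) / r"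
    using assms by (simp add: field_simps)
  then show ?thesis
    using assms by (simp add: hyp_coeff_def mult_ac)
qed

text \<open>With \<open>t n\<close> for the coefficients at \<open>r\<close>, the difference of the
  two sides is the series of \<open>r * (n * t n - (n + 1) * t (n + 1))\<close>. It telescopes to 0,
  because \<open>n * t n\<close> is 0 at \<open>n = 0\<close> and tends to 0.\<close>

lemma hyp2F1_at_1_contiguous:
  assumes r: "r > 0" and pq: "p + q < r"
  shows "r * (r - p - q) * hyp2F1 p q r 1 = (r - p) * (r - q) * hyp2F1 p q (r + 1) 1"
proof -
  let ?t = "hyp_coeff p q r" and ?s = "\<lambda>n. real n * hyp_coeff p q r n"
  have "(\<lambda>n. ?s n - ?s (Suc n)) sums (?s 0 - 0)"
    by (rule telescope_sums'[OF hyp_coeff_times_n_tendsto_0[OF r pq]])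
  then have "(\<lambda>n. r * (?s n - ?s (Suc n))) sums 0"
    using sums_mult[of _ 0 r] by simp
  also have "(\<lambda>n. r * (?s n - ?s (Suc n)))
      = (\<lambda>n. r * (r - p - q) * ?t n - (r - p) * (r - q) * hyp_coeff p q (r + 1) n)"
  proof
    fix n
    \<comment> \<open>Both the next coefficient and the one at \<open>r + 1\<close> are rational
      multiples of \<open>hyp_coeff p q r n\<close>, so only an identity of rational functions
      remains, linear in \<open>T\<close>.\<close>
    have "r * (r - p - q) * T - (r - p) * (r - q) * (r / (r + real n) * T)
        = r * (real n * T - (p + real n) * (q + real n) / (r + real n) * T)" for T
    proof -
      have "r + real n > 0"
        using r by (simp add: add_pos_nonneg)
      then show ?thesis
        by (simp add: divide_simps) (simp add: algebra_simps)
    qed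
    then show "r * (?s n - ?s (Suc n))
        = r * (r - p - q) * ?t n - (r - p) * (r - q) * hyp_coeff p q (r + 1) n"
      using hyp_coeff_Suc[OF r, of n p q] by (simp add: hyp_coeff_plus1[OF r] del: of_nat_Suc)
  qed
  finally have "(\<lambda>n. r * (r - p - q) * ?t n - (r - p) * (r - q) * hyp_coeff p q (r + 1) n) sums 0" .
  moreover have "(\<lambda>n. r * (r - p - q) * ?t n - (r - p) * (r - q) * hyp_coeff p q (r + 1) n)
      sums (r * (r - p - q) * hyp2F1 p q r 1 - (r - p) * (r - q) * hyp2F1 p q (r + 1) 1)"
    unfolding hyp2F1_altdef
    using summable_norm_cancel[OF summable_hyp_coeff[of r p q]]
      summable_norm_cancel[OF summable_hyp_coeff[of "r+1" p q]] r pq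
    by (intro sums_diff sums_mult) (auto simp: summable_sums)
  ultimately have "0 = r * (r - p - q) * hyp2F1 p q r 1 - (r - p) * (r - q) * hyp2F1 p q (r + 1) 1"
    by (rule sums_unique2)
  then show ?thesis
    by linarith
qed

subsection \<open>Beta integrals of the hypergeometric function\<close>

lemma has_bochner_integral_Beta:
  fixes a b :: real
  assumes "a > 0" "b > 0"
  shows "has_bochner_integral lborel
           (\<lambda>x. x powr (a - 1) * (1 - x) powr (b - 1) * indicator {0<..<1} x) (Beta a b)"
proof (rule has_bochner_integral_nn_integral)
  let ?f = "\<lambda>x::real. x powr (a - 1) * (1 - x) powr (b - 1)"
  have "(?f has_integral Beta a b) {0<..<1}"
    using has_integral_Beta_real[OF assms] by (simp add: has_integral_Icc_iff_Ioo)
  then have "((\<lambda>x. ?f x * indicator {0<..<1} x) has_integral Beta a b) UNIV"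
    unfolding has_integral_restrict_UNIV[of "{0<..<1}", symmetric]
    by (rule has_integral_eq[rotated]) auto
  then show "(\<integral>\<^sup>+x. ennreal (?f x * indicator {0<..<1} x) \<partial>lborel) = ennreal (Beta a b)"
    by (intro nn_integral_has_integral_lborel) auto
  show "Beta a b \<ge> 0"
    using assms Gamma_real_pos[of a] Gamma_real_pos[of b] Gamma_real_pos[of "a + b"]
    by (simp add: Beta_def)
qed auto

lemma borel_measurable_hyp2F1 [measurable]: "hyp2F1 p q r \<in> borel_measurable borel"
  unfolding hyp2F1_def by measurable

text \<open>Since \<open>Gamma (x + n) = pochhammer x n * Gamma x\<close>, the factor
  \<open>pochhammer r n\<close> cancels and \<open>pochhammer (r + c) n\<close> takes its place.
  Integration against a Beta kernel thus raises the lower parameter, provided that the exponent of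
  \<open>x\<close> matches it.\<close>

lemma hyp_coeff_times_Beta:
  assumes "r > 0" "c > 0"
  shows "hyp_coeff p q r n * Beta (r + n) c = Beta r c * hyp_coeff p q (r + c) n"
proof -
  have *: "Gamma (x + n) = pochhammer x n * Gamma x" if "x > 0" for x :: real
  proof -
    have "x \<notin> \<int>\<^sub>\<le>\<^sub>0"
      using that by (auto elim!: nonpos_Ints_cases')
    then show ?thesis
      using Gamma_real_pos[OF that] by (simp add: pochhammer_Gamma)
  qed
  have "Beta (r + n) c = Beta r c * pochhammer r n / pochhammer (r + c) n"
    using *[of r] *[of "r + c"] assms by (simp add: Beta_def algebra_simps)
  then show ?thesis
    using assms pochhammer_nonzero[of r n] by (simp add: hyp_coeff_def)
qed

text \<open>Termwise integration is justified by absolute convergence: the integrals of the absolute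
  values are \<open>Beta r c\<close> times the absolute coefficients at \<open>r + c\<close>, which
  are summable as \<open>p + q < r + c\<close>.\<close>

lemma has_bochner_integral_hyp2F1_Beta:
  assumes r: "r > 0" and c: "c > 0" and pq: "p + q < r + c"
  shows "has_bochner_integral lborel
           (\<lambda>x. x powr (r - 1) * (1 - x) powr (c - 1) * hyp2F1 p q r x * indicator {0<..<1} x)
           (Beta r c * hyp2F1 p q (r + c) 1)"
proof -
  define g where "g n x = x powr (r + real n - 1) * (1 - x) powr (c - 1) * indicator {0<..<1} x"
    for n and x :: real
  have g: "has_bochner_integral lborel (g n) (Beta (r + n) c)" for n
    unfolding g_def using r c by (intro has_bochner_integral_Beta) auto
  then have int: "integrable lborel (\<lambda>x. hyp_coeff p q r n * g n x)"
    and I: "(\<integral>x. hyp_coeff p q r n * g n x \<partial>lborel) = Beta r c * hyp_coeff p q (r + c) n" for n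
    using hyp_coeff_times_Beta[OF r c, of p q n] by (auto simp: has_bochner_integral_iff)
  have Beta_nonneg: "Beta (r + real n) c \<ge> 0" for n
    using r c Gamma_real_pos[of c] Gamma_real_pos[of "r + real n"] Gamma_real_pos[of "r + real n + c"]
    by (simp add: Beta_def)
  have g_eq: "hyp_coeff p q r n * g n x
      = x powr (r - 1) * (1 - x) powr (c - 1) * indicator {0<..<1} x * (hyp_coeff p q r n * x ^ n)" for n x
    by (auto simp: g_def powr_add powr_realpow powr_diff split: split_indicator)
  have g_nonneg: "g n x \<ge> 0" for n x
    by (simp add: g_def)
  have summ: "summable (\<lambda>n. norm (hyp_coeff p q r n * g n x))" for x
  proof (cases "x \<in> {0<..<1}")
    case True
    then show ?thesis
      unfolding g_eq norm_mult[of "x powr (r - 1) * (1 - x) powr (c - 1) * indicator {0<..<1} x"]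
      using summable_hyp2F1[OF r, of x p q] by (intro summable_mult) auto
  qed (simp add: g_def)
  have "(\<integral>x. norm (hyp_coeff p q r n * g n x) \<partial>lborel) = Beta r c * norm (hyp_coeff p q (r + c) n)" for n
  proof -
    have "(\<integral>x. norm (hyp_coeff p q r n * g n x) \<partial>lborel) = \<bar>hyp_coeff p q r n\<bar> * Beta (r + n) c"
      using g[of n] g_nonneg by (simp add: abs_mult has_bochner_integral_iff)
    also have "\<dots> = \<bar>hyp_coeff p q r n * Beta (r + n) c\<bar>"
      using Beta_nonneg[of n] by (simp add: abs_mult)
    finally show ?thesis
      using Beta_nonneg[of 0] by (simp add: hyp_coeff_times_Beta[OF r c] abs_mult)
  qed
  then have sums: "summable (\<lambda>n. \<integral>x. norm (hyp_coeff p q r n * g n x) \<partial>lborel)"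
    using summable_hyp_coeff[of "r + c" p q] r c pq by (simp add: summable_mult)
  have suminf_eq: "(\<Sum>n. hyp_coeff p q r n * g n x)
      = x powr (r - 1) * (1 - x) powr (c - 1) * hyp2F1 p q r x * indicator {0<..<1} x" for x
  proof (cases "x \<in> {0<..<1}")
    case True
    then have "summable (\<lambda>n. hyp_coeff p q r n * x ^ n)"
      using summable_norm_cancel[OF summable_hyp2F1[OF r, of x p q]] by auto
    then show ?thesis
      unfolding g_eq hyp2F1_altdef by (subst suminf_mult) auto
  qed (simp add: g_def)
  have "summable (\<lambda>n. hyp_coeff p q (r + c) n)"
    using summable_norm_cancel[OF summable_hyp_coeff[of "r + c" p q]] r c pq by auto
  then have "(\<Sum>n. Beta r c * hyp_coeff p q (r + c) n) = Beta r c * hyp2F1 p q (r + c) 1"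
    unfolding hyp2F1_altdef by (subst suminf_mult) auto
  then show ?thesis
    using integrable_suminf[OF int _ sums] integral_suminf[OF int _ sums] summ
    unfolding suminf_eq I by (auto simp: has_bochner_integral_iff)
qed

text \<open>Joins the recurrence of \<open>Beta\<close> in its second argument to the contiguous
  relation at \<open>r + c\<close>. Being free of division, the relation can be used to determine
  the signs of the factors on the left.\<close>

lemma hyp2F1_Beta_integral_plus1:
  fixes r c :: real
  assumes "r > 0" "c > 0" "p + q < r + c"
  shows "(r + c - p) * (r + c - q) * (Beta r (c + 1) * hyp2F1 p q (r + (c + 1)) 1)
           = c * (r + c - p - q) * (Beta r c * hyp2F1 p q (r + c) 1)"
proof -
  have "(r + c) * Beta r (c + 1) = c * Beta r c"
    using assms by (intro Beta_plus1_right) (auto elim!: nonpos_Ints_cases')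
  then have B: "Beta r (c + 1) = c * Beta r c / (r + c)"
    using assms by (simp add: field_simps)
  have F: "(r + c - p) * (r + c - q) * hyp2F1 p q (r + (c + 1)) 1 = (r + c) * (r + c - p - q) * hyp2F1 p q (r + c) 1"
    using hyp2F1_at_1_contiguous[of "r + c" p q] assms by (simp add: add.assoc)
  have "(r + c - p) * (r + c - q) * (Beta r (c + 1) * hyp2F1 p q (r + (c + 1)) 1)
      = Beta r (c + 1) * ((r + c - p) * (r + c - q) * hyp2F1 p q (r + (c + 1)) 1)"
    by (simp only: mult_ac)
  also have "\<dots> = c * (r + c - p - q) * (Beta r c * hyp2F1 p q (r + c) 1)"
    unfolding F B using assms by simp
  finally show ?thesis .
qed

text \<open>The value is the integral of a nonnegative function that is positive on a set of
  positive measure. In this way positivity on the open interval yields the sign of a value at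
  1.\<close>

lemma hyp2F1_Beta_integral_pos:
  assumes "r > 0" "c > 0" "p + q < r + c"
    and "\<And>x. x \<in> {0<..<1} \<Longrightarrow> hyp2F1 p q r x > 0"
  shows "Beta r c * hyp2F1 p q (r + c) 1 > 0"
proof -
  let ?f = "\<lambda>x. x powr (r - 1) * (1 - x) powr (c - 1) * hyp2F1 p q r x * indicator {0<..<1} x"
  have pos: "?f x > 0" if "x \<in> {0<..<1}" for x
    using that assms(4)[OF that] by simp
  have nonneg: "?f x \<ge> 0" for x
    using pos[of x] by (cases "x \<in> {0<..<1}") auto
  have *: "integrable lborel ?f" "integral\<^sup>L lborel ?f = Beta r c * hyp2F1 p q (r + c) 1"
    using has_bochner_integral_hyp2F1_Beta[OF assms(1-3)] by (auto simp: has_bochner_integral_iff)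
  have "integral\<^sup>L lborel ?f \<noteq> 0"
  proof
    assume "integral\<^sup>L lborel ?f = 0"
    then have "AE x in lborel. ?f x = 0"
      using nonneg by (subst (asm) integral_nonneg_eq_0_iff_AE[OF *(1)]) auto
    then have "AE x in lborel. x \<notin> {0<..<1::real}"
    proof eventually_elim
      case (elim x)
      then show ?case
        using pos[of x] by fastforce
    qed
    then have "{0<..<1::real} \<in> null_sets lborel"
      by (subst AE_iff_null_sets) auto
    then show False
      by auto
  qed
  moreover have "integral\<^sup>L lborel ?f \<ge> 0"
    using nonneg by (intro Bochner_Integration.integral_nonneg) auto
  ultimately show ?thesis
    using *(2) by linarith
qed

text \<open>Iterates the recurrence; \<open>p < r + c\<close> and \<open>q < r + c\<close> keep all
  divisors positive.\<close>

lemma hyp2F1_Beta_integral_shift: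
  assumes "r > 0" "c > 0" "p + q < r + c" "p < r + c" "q < r + c"
  shows "Beta r (c + n) * hyp2F1 p q (r + (c + n)) 1
           = pochhammer c n * pochhammer (r + c - p - q) n
               / (pochhammer (r + c - p) n * pochhammer (r + c - q) n)
             * (Beta r c * hyp2F1 p q (r + c) 1)"
proof (induction n)
  case (Suc n)
  let ?J = "\<lambda>c. Beta r c * hyp2F1 p q (r + c) 1"
  have "(r + (c + n) - p) * (r + (c + n) - q) * ?J (c + n + 1) = (c + n) * (r + (c + n) - p - q) * ?J (c + n)"
    using assms by (intro hyp2F1_Beta_integral_plus1) auto
  then have J: "?J (c + n + 1)
      = (c + n) * (r + (c + n) - p - q) / ((r + (c + n) - p) * (r + (c + n) - q)) * ?J (c + n)"
    using assms by (subst times_divide_eq_left, intro eq_divide_imp) (auto simp: mult.commute)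
  have "c + real (Suc n) = c + n + 1" "r + (c + n) - p = r + c - p + n"
    "r + (c + n) - q = r + c - q + n" "r + c - p + n - q = r + c - p - q + n"
    by simp_all
  then show ?case
    using J unfolding Suc.IH pochhammer_Suc by (simp only: times_divide_eq_left times_divide_eq_right divide_divide_eq_left mult_ac)
qed simp

lemma sums_pochhammer_powr:
  fixes s z :: real
  assumes "\<bar>z\<bar> < 1"
  shows "(\<lambda>n. pochhammer s n / fact n * z ^ n) sums (1 - z) powr - s"
proof -
  \<comment> \<open>The sign \<open>(-1) ^ n\<close> of the binomial coefficient at
    \<open>- s\<close> cancels that of \<open>(- z) ^ n\<close>.\<close>
  have "(- s gchoose n) * (- z) ^ n = pochhammer s n / fact n * z ^ n" for n
    by (simp add: gbinomial_pochhammer power_mult_distrib[symmetric] flip: mult.assoc power_minus)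
  then show ?thesis
    using gen_binomial_real[of "- z" "- s"] assms by simp
qed

text \<open>With this exponent, \<open>pochhammer (r + c - p) n\<close> from the binomial series
  cancels the same factor in \<open>hyp2F1_Beta_integral_shift\<close>, and the coefficients of the
  new series are left. All terms are nonnegative, so sum and integral commute by monotone
  convergence.\<close>

lemma nn_integral_hyp2F1_powr:
  assumes r: "r > 0" and c: "c > 0" and pq: "p + q < r + c" "p < r + c" "q < r + c"
    and pos: "\<And>x. x \<in> {0<..<1} \<Longrightarrow> hyp2F1 p q r x > 0"
    and y: "y \<in> {0<..<1}"
  shows "(\<integral>\<^sup>+x. ennreal (x powr (r - 1) * (1 - x) powr (c - 1) * hyp2F1 p q r x * indicator {0<..<1} x
             * (1 - y * (1 - x)) powr - (r + c - p)) \<partial>lborel)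
         = ennreal (Beta r c * hyp2F1 p q (r + c) 1 * hyp2F1 (r + c - p - q) c (r + c - q) y)"
    (is "?lhs = ennreal (?J * _)")
proof -
  define k where "k d x = x powr (r - 1) * (1 - x) powr (d - 1) * hyp2F1 p q r x * indicator {0<..<1} x"
    for d and x :: real
  have k_nonneg: "k d x \<ge> 0" for d x
    using pos[of x] by (cases "x \<in> {0<..<1}") (auto simp: k_def)
  have k_meas [measurable]: "k d \<in> borel_measurable borel" for d
    unfolding k_def by measurable
  have J_pos: "?J > 0"
    by (rule hyp2F1_Beta_integral_pos) (use assms in auto)
  define s where "s = r + c - p"
  have s: "s > 0"
    using pq by (simp add: s_def)
  have term_nonneg: "pochhammer s n / fact n * y ^ n \<ge> 0" for n
    using pochhammer_pos[OF s, of n] y by simp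
  have series: "k c x * (1 - y * (1 - x)) powr - s = (\<Sum>n. pochhammer s n / fact n * y ^ n * k (c + n) x)
        \<and> summable (\<lambda>n. pochhammer s n / fact n * y ^ n * k (c + n) x)" for x
  proof (cases "x \<in> {0<..<1}")
    case True
    have "\<bar>y * (1 - x)\<bar> < 1"
      using y True mult_strict_mono[of y 1 "1 - x" 1] by (simp add: abs_mult)
    then have "(\<lambda>n. k c x * (pochhammer s n / fact n * (y * (1 - x)) ^ n)) sums (k c x * (1 - y * (1 - x)) powr - s)"
      by (intro sums_mult sums_pochhammer_powr)
    \<comment> \<open>The power \<open>(1 - x) ^ n\<close> is absorbed into the kernel and raises
      its parameter from \<open>c\<close> to \<open>c + n\<close>.\<close>
    moreover have "k c x * (pochhammer s n / fact n * (y * (1 - x)) ^ n)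
        = pochhammer s n / fact n * y ^ n * k (c + n) x" for n
      using True by (simp add: k_def powr_add powr_realpow powr_diff power_mult_distrib mult_ac)
    ultimately show ?thesis
      by (simp only: sums_iff)
  qed (simp add: k_def)
  have "?lhs = (\<integral>\<^sup>+x. (\<Sum>n. ennreal (pochhammer s n / fact n * y ^ n * k (c + n) x)) \<partial>lborel)"
    unfolding k_def[symmetric] s_def[symmetric]
    using series mult_nonneg_nonneg[OF term_nonneg k_nonneg]
    by (intro nn_integral_cong, subst suminf_ennreal2) auto
  also have "\<dots> = (\<Sum>n. \<integral>\<^sup>+x. ennreal (pochhammer s n / fact n * y ^ n * k (c + n) x) \<partial>lborel)"
    by (intro nn_integral_suminf) auto
  also have "\<dots> = (\<Sum>n. ennreal (?J * (hyp_coeff (r + c - p - q) c (r + c - q) n * y ^ n)))"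
  proof (intro suminf_cong)
    fix n
    have "(\<integral>\<^sup>+x. ennreal (pochhammer s n / fact n * y ^ n * k (c + n) x) \<partial>lborel)
        = ennreal (pochhammer s n / fact n * y ^ n) * (\<integral>\<^sup>+x. ennreal (k (c + n) x) \<partial>lborel)"
      unfolding ennreal_mult[OF term_nonneg k_nonneg] by (rule nn_integral_cmult) simp
    also have "(\<integral>\<^sup>+x. ennreal (k (c + n) x) \<partial>lborel)
        = ennreal (Beta r (c + n) * hyp2F1 p q (r + (c + n)) 1)"
      using has_bochner_integral_hyp2F1_Beta[of r "c + n" p q] assms k_nonneg
      unfolding k_def[symmetric] has_bochner_integral_iff
      by (subst nn_integral_eq_integral) auto
    also have "ennreal (pochhammer s n / fact n * y ^ n) * \<dots>
        = ennreal (?J * (hyp_coeff (r + c - p - q) c (r + c - q) n * y ^ n))"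
      using term_nonneg[of n] pochhammer_nonzero[OF s, of n]
      unfolding hyp2F1_Beta_integral_shift[OF r c pq]
      by (subst ennreal_mult'[symmetric]) (auto simp: hyp_coeff_def s_def[symmetric] mult_ac)
    finally show "(\<integral>\<^sup>+x. ennreal (pochhammer s n / fact n * y ^ n * k (c + n) x) \<partial>lborel)
        = ennreal (?J * (hyp_coeff (r + c - p - q) c (r + c - q) n * y ^ n))" .
  qed
  also have "\<dots> = ennreal (?J * hyp2F1 (r + c - p - q) c (r + c - q) y)"
  proof (rule suminf_ennreal_eq)
    show "0 \<le> ?J * (hyp_coeff (r + c - p - q) c (r + c - q) n * y ^ n)" for n
      using J_pos hyp_coeff_pos[of "r + c - p - q" c "r + c - q" n] y pq c by simp
    have "summable (\<lambda>n. hyp_coeff (r + c - p - q) c (r + c - q) n * y ^ n)"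
      by (rule summable_norm_cancel[OF summable_hyp2F1]) (use y pq in auto)
    then show "(\<lambda>n. ?J * (hyp_coeff (r + c - p - q) c (r + c - q) n * y ^ n))
        sums (?J * hyp2F1 (r + c - p - q) c (r + c - q) y)"
      unfolding hyp2F1_altdef by (intro sums_mult summable_sums)
  qed
  finally show ?thesis .
qed

subsection \<open>The law of the transformed variable\<close>

lemma vector_5:
  fixes x1 x2 x3 x4 x5 :: "'a::zero"
  shows "(vector [x1, x2, x3, x4, x5] :: 'a^5) $ 1 = x1"
    "(vector [x1, x2, x3, x4, x5] :: 'a^5) $ 2 = x2"
    "(vector [x1, x2, x3, x4, x5] :: 'a^5) $ 3 = x3"
    "(vector [x1, x2, x3, x4, x5] :: 'a^5) $ 4 = x4"
    "(vector [x1, x2, x3, x4, x5] :: 'a^5) $ 5 = x5"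
  unfolding vector_def by simp_all

lemma exhaust_5:
  fixes x :: 5
  shows "x = 1 \<or> x = 2 \<or> x = 3 \<or> x = 4 \<or> x = 5"
proof (induct x)
  case (of_int z)
  \<comment> \<open>The representatives modulo 5 are 0 to 4, and the residue 0 is the index
    \<open>5\<close>.\<close>
  then have "z = 0 \<or> z = 1 \<or> z = 2 \<or> z = 3 \<or> z = 4" by fastforce
  then show ?case by auto
qed

lemma forall_5: "(\<forall>i::5. P i) \<longleftrightarrow> P 1 \<and> P 2 \<and> P 3 \<and> P 4 \<and> P 5"
  by (metis exhaust_5)

lemma UNIV_5: "UNIV = {1, 2, 3, 4, 5::5}"
  using exhaust_5 by auto

lemma sum_5: "sum f (UNIV :: 5 set) = f 1 + f 2 + f 3 + f 4 + f 5"
  unfolding UNIV_5 by (simp add: ac_simps)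

lemma M_mat_mult:
  "M_mat *v vector [a, b, p, q, r] = vector [r - a, a + b - p, r + b - p - q, b, r + b - q]"
  by (simp add: vec_eq_iff forall_5 matrix_vector_mult_def sum_5 vector_5 M_mat_def)

lemma Pi_mat_mult: "Pi_mat *v vector [a, b, p, q, r] = vector [a + b - p, r - a]"
  by (simp add: vec_eq_iff forall_2 matrix_vector_mult_def sum_5 vector_5 Pi_mat_def)

section \<open>The substitution \<open>y = 1 / (1 + x * w)\<close>\<close>

text \<open>The density is the absolute derivative of the decreasing map
  \<open>w \<mapsto> 1 / (1 + x * w)\<close> from the positive half-line onto the unit interval. The
  two measures are compared on the half-lines \<open>{t<..}\<close>, where the fundamental theorem
  of calculus with antiderivative \<open>?F\<close> gives the mass.\<close>

lemma distr_one_over_one_plus_mult: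
  fixes x :: real
  assumes x: "x > 0"
  shows "distr (density lborel (\<lambda>w. ennreal (x / (1 + x * w)\<^sup>2 * indicator {0<..} w))) borel (\<lambda>w. 1 / (1 + x * w))
       = density lborel (indicator {0<..<1})" (is "?A = ?B")
proof (rule sym, rule measure_eqI_lessThan)
  let ?f = "\<lambda>w. x / (1 + x * w)\<^sup>2" and ?F = "\<lambda>w. - 1 / (1 + x * w)"
  have B: "emeasure ?B {t<..} = emeasure lborel ({0<..<1} \<inter> {t<..})" for t :: real
    by (simp add: emeasure_restricted)
  have "emeasure lborel ({0<..<1} \<inter> {t<..}) \<le> emeasure lborel {0<..<1::real}" for t :: real
    by (rule emeasure_mono) auto
  then show "emeasure ?B {t<..} < \<infinity>" for t
    unfolding B by (rule order.strict_trans1) simp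
  have A: "emeasure ?A {t<..} = (\<integral>\<^sup>+w. ennreal (?f w) * indicator {w. 0 < w \<and> t < 1 / (1 + x * w)} w \<partial>lborel)" for t
  proof -
    have [measurable]: "(\<lambda>w. 1 / (1 + x * w)) -` {t<..} \<in> sets borel"
      by (rule measurable_sets_borel[where M = borel]) auto
    show ?thesis
      by (subst emeasure_distr, simp, simp, subst emeasure_density)
         (auto intro!: nn_integral_cong simp: indicator_def)
  qed
  have deriv: "(?F has_real_derivative ?f w) (at w)" if "w \<ge> 0" for w
  proof -
    have "1 + x * w > 0"
      using x that by (simp add: add_pos_nonneg)
    then show ?thesis
      by (auto intro!: derivative_eq_intros simp: power2_eq_square)
  qed
  show "emeasure ?B {t<..} = emeasure ?A {t<..}" for t
  proof -
    consider "t \<le> 0" | "0 < t" "t < 1" | "1 \<le> t"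
      by linarith
    then show ?thesis
    proof cases
      case 1
      \<comment> \<open>The condition on \<open>t\<close> is void for \<open>w > 0\<close>, and the
        added point 0 is a null set.\<close>
      have "emeasure ?A {t<..} = (\<integral>\<^sup>+w. ennreal (?f w) * indicator {0..} w \<partial>lborel)"
        unfolding A
      proof (rule nn_integral_cong_AE)
        show "AE w in lborel. ennreal (?f w) * indicator {w. 0 < w \<and> t < 1 / (1 + x * w)} w
            = ennreal (?f w) * indicator {0..} w"
          using AE_lborel_singleton[of "0::real"]
        proof eventually_elim
          case (elim w)
          have "t < 1 / (1 + x * w)" if "w > 0"
            using 1 x that by (intro le_less_trans[OF 1]) (simp add: add_pos_pos)
          then show ?case
            using elim by (auto simp: indicator_def)
        qed
      qed
      also have "\<dots> = ennreal (0 - ?F 0)"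
      proof (rule nn_integral_FTC_atLeast)
        show "(?F \<longlongrightarrow> 0) at_top"
          using x by real_asymp
      qed (use deriv x in auto)
      also have "\<dots> = emeasure lborel {0<..<1::real}"
        by simp
      also have "{0<..<1} = {0<..<1} \<inter> {t<..}"
        using 1 by auto
      finally show ?thesis
        unfolding B by simp
    next
      case 2
      \<comment> \<open>The solution \<open>w\<close> of \<open>1 / (1 + x * w) = t\<close>; the
        mass is then \<open>?F c - ?F 0 = 1 - t\<close>.\<close>
      define c where "c = (1 - t) / (t * x)"
      have c: "c > 0"
        using 2 x by (simp add: c_def)
      have c_iff: "t < 1 / (1 + x * w) \<longleftrightarrow> w < c" if "w > 0" for w
      proof -
        have "1 + x * w > 0"
          using x that by (simp add: add_pos_pos)
        then show ?thesis
          using 2 x by (simp add: c_def field_simps)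
      qed
      have Fc: "?F c = - t"
        using 2 x by (simp add: c_def field_simps)
      have "emeasure ?A {t<..} = (\<integral>\<^sup>+w. ennreal (?f w) * indicator {0..c} w \<partial>lborel)"
        unfolding A
      proof (rule nn_integral_cong_AE)
        show "AE w in lborel. ennreal (?f w) * indicator {w. 0 < w \<and> t < 1 / (1 + x * w)} w
            = ennreal (?f w) * indicator {0..c} w"
          using AE_lborel_singleton[of "0::real"] AE_lborel_singleton[of c]
        proof eventually_elim
          case (elim w)
          then show ?case
            using c_iff[of w] by (auto simp: indicator_def)
        qed
      qed
      also have "\<dots> = ennreal (?F c - ?F 0)"
        by (rule nn_integral_FTC_Icc) (use deriv x c in auto)
      also have "\<dots> = emeasure lborel {t<..<1}"
        using Fc 2 by simp
      also have "{t<..<1} = {0<..<1} \<inter> {t<..}"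
        using 2 by auto
      finally show ?thesis
        unfolding B by simp
    next
      case 3
      have "\<not> t < 1 / (1 + x * w)" if "w > 0" for w
      proof -
        have "0 \<le> x * w"
          using x that by simp
        then have "1 / (1 + x * w) \<le> 1"
          by simp
        then show ?thesis
          using 3 by linarith
      qed
      then have "emeasure ?A {t<..} = (\<integral>\<^sup>+w. 0 \<partial>(lborel :: real measure))"
        unfolding A by (intro nn_integral_cong) (auto simp: indicator_def)
      moreover have "{0<..<1} \<inter> {t<..} = {}"
        using 3 by auto
      ultimately show ?thesis
        unfolding B by simp
    qed
  qed
qed simp_all

lemma nn_integral_one_over_one_plus_mult:
  fixes x :: real
  assumes x: "x > 0" and [measurable]: "g \<in> borel_measurable borel"
  shows "(\<integral>\<^sup>+w. ennreal (x / (1 + x * w)\<^sup>2 * indicator {0<..} w) * g (1 / (1 + x * w)) \<partial>lborel)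
       = (\<integral>\<^sup>+y. indicator {0<..<1} y * g y \<partial>lborel)"
proof -
  have "(\<integral>\<^sup>+w. ennreal (x / (1 + x * w)\<^sup>2 * indicator {0<..} w) * g (1 / (1 + x * w)) \<partial>lborel)
     = (\<integral>\<^sup>+y. g y \<partial>distr (density lborel (\<lambda>w. ennreal (x / (1 + x * w)\<^sup>2 * indicator {0<..} w))) borel (\<lambda>w. 1 / (1 + x * w)))"
    by (subst nn_integral_distr, simp, simp, subst nn_integral_density) auto
  also have "\<dots> = (\<integral>\<^sup>+y. indicator {0<..<1} y * g y \<partial>lborel)"
    unfolding distr_one_over_one_plus_mult[OF x] by (subst nn_integral_density) auto
  finally show ?thesis .
qed

text \<open>Splits off the Jacobian, so that the other factor, a function of \<open>y\<close>, is
  the density of \<open>1 / (1 + x * W)\<close> for fixed \<open>x\<close>. The identities behind it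
  are \<open>w = (1 - y) / (x * y)\<close> and
  \<open>1 + w = (1 - y * (1 - x)) / (x * y)\<close>.\<close>

lemma beta2_density_eq:
  fixes x w c d :: real
  assumes x: "x > 0" and w: "w > 0"
  defines "y \<equiv> 1 / (1 + x * w)"
  shows "beta2_density c d w = x / (1 + x * w)\<^sup>2 *
    (1 / Beta c d * x powr d * (1 - y) powr (c - 1) * y powr (d - 1) * (1 - y * (1 - x)) powr - (c + d))"
proof -
  define u where "u = 1 + x * w"
  have u: "u > 0"
    using x w by (simp add: u_def add_pos_pos)
  have y: "y = 1 / u" "1 - y = x * w / u" "1 - y * (1 - x) = x * (1 + w) / u"
    using u by (auto simp: y_def u_def field_simps)
  have "beta2_density c d w = 1 / Beta c d * (w powr (c - 1) / (1 + w) powr (c + d))"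
    using w by (simp add: beta2_density_def)
  also have "w powr (c - 1) / (1 + w) powr (c + d)
      = x / u\<^sup>2 * (x powr d * (1 - y) powr (c - 1) * y powr (d - 1) * (1 - y * (1 - x)) powr - (c + d))"
    using x w u
    by (subst y(3), subst y(2), subst y(1))
       (simp add: powr_mult powr_divide powr_minus powr_diff powr_add power2_eq_square divide_simps mult_ac)
  finally show ?thesis
    unfolding u_def by simp
qed

text \<open>Total mass 1 determines \<open>K\<close>, so a density found up to a constant factor is
  enough and the normalising integral never has to be evaluated.\<close>

lemma (in prob_space) distributed_normalize:
  fixes f :: "real \<Rightarrow> real"
  assumes D: "distributed M lborel Y (\<lambda>y. ennreal (K * f y))"
    and f: "\<And>y. f y \<ge> 0" "f \<in> borel_measurable borel" and K: "K \<ge> 0"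
  shows "distributed M lborel Y (\<lambda>y. ennreal (f y / (\<integral>y. f y \<partial>lborel)))"
proof -
  have "(\<integral>\<^sup>+y. ennreal (K * f y) \<partial>lborel) = emeasure (density lborel (\<lambda>y. ennreal (K * f y))) (space lborel)"
    using f(2) by (subst emeasure_density) auto
  also have "\<dots> = emeasure (distr M lborel Y) (space lborel)"
    using D by (simp add: distributed_def)
  also have "\<dots> = 1"
    using distributed_measurable[OF D] prob_space.emeasure_space_1[OF prob_space_distr]
    by (metis space_distr)
  finally have "(\<integral>\<^sup>+y. ennreal (K * f y) \<partial>lborel) = ennreal 1"
    by simp
  then have "has_bochner_integral lborel (\<lambda>y. K * f y) 1"
    using f K by (intro has_bochner_integral_nn_integral) auto
  then have "K * (\<integral>y. f y \<partial>lborel) = 1"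
    by (simp add: has_bochner_integral_iff)
  then have "K = 1 / (\<integral>y. f y \<partial>lborel)"
    by (metis eq_divide_imp mult_zero_right zero_neq_one)
  then show ?thesis
    using D by simp
qed

section \<open>Mixing the conditional laws over \<open>X\<close>\<close>

lemma borel_measurable_BH_kernel [measurable]: "BH_kernel v \<in> borel_measurable borel"
  unfolding BH_kernel_def by measurable

lemma BH_kernel_nonneg: "v \<in> BH_params \<Longrightarrow> BH_kernel v x \<ge> 0"
  by (cases "x \<in> {0<..<1}") (auto simp: BH_kernel_def BH_params_def less_imp_le)

lemma (in prob_space) distributed_one_over_one_plus_mult:
  fixes a b p q r :: real and X W :: "'a \<Rightarrow> real"
  defines "v \<equiv> vector [a, b, p, q, r] :: real^5"
    and "u \<equiv> vector [r - a, a + b - p, r + b - p - q, b, r + b - q] :: real^5"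
  assumes v: "v \<in> BH_params" and u: "u \<in> BH_params"
    and p: "a + b - p > 0" and a: "r - a > 0" and q: "r + b - q > 0"
    and X: "distributed M lborel X (\<lambda>x. ennreal (BH_density v x))"
    and W: "distributed M lborel W (\<lambda>w. ennreal (beta2_density (a + b - p) (r - a) w))"
    and indep: "indep_var borel X borel W"
  shows "distributed M lborel (\<lambda>\<omega>. 1 / (1 + X \<omega> * W \<omega>)) (\<lambda>y. ennreal (BH_density u y))"
proof -
  define c d where "c = a + b - p" and "d = r - a"
  \<comment> \<open>If this integral were 0, or took the default value 0 for a non-integrable
    kernel, division by 0 would still make the density identities below hold;
    \<open>C \<ge> 0\<close> therefore suffices for them.\<close>
  define C where "C = (\<integral>x. BH_kernel v x \<partial>lborel)"
  define J where "J = Beta r b * hyp2F1 p q (r + b) 1"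
  define K where "K = J / (C * Beta c d)"
  have ab: "a > 0" "b > 0" "r > 0" "r + b - p - q > 0" and F_pos: "\<And>x. x \<in> {0<..<1} \<Longrightarrow> hyp2F1 p q r x > 0"
    using v a by (auto simp: v_def BH_params_def vector_5)
  have cd: "c > 0" "d > 0" "c + d = r + b - p"
    using p a by (simp_all add: c_def d_def)
  have C: "C \<ge> 0"
    unfolding C_def using BH_kernel_nonneg[OF v] by (intro Bochner_Integration.integral_nonneg) auto
  have B: "Beta c d > 0"
    using cd Gamma_real_pos[of c] Gamma_real_pos[of d] Gamma_real_pos[of "c + d"] by (simp add: Beta_def)
  have J: "J > 0"
    unfolding J_def by (rule hyp2F1_Beta_integral_pos) (use ab F_pos in auto)
  have K: "K \<ge> 0"
    using J C B by (simp add: K_def)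
  have X_nonneg: "BH_density v x \<ge> 0" for x
    using BH_kernel_nonneg[OF v, of x] C by (simp add: BH_density_def C_def)
  have W_nonneg: "beta2_density c d w \<ge> 0" for w
    using B by (simp add: beta2_density_def)
  have [measurable]: "X \<in> borel_measurable M" "W \<in> borel_measurable M"
    using distributed_measurable[OF X] distributed_measurable[OF W] by simp_all
  have [measurable]: "BH_density v \<in> borel_measurable borel"
    unfolding BH_density_def by measurable
  have [measurable]: "beta2_density c d \<in> borel_measurable borel"
    unfolding beta2_density_def by measurable
  \<comment> \<open>Independence involves only the sigma-algebras, on which \<open>borel\<close> and
    \<open>lborel\<close> agree.\<close>
  have "indep_var lborel X lborel W"
    using indep by (simp add: indep_var_eq)
  then have XW: "distributed M (lborel \<Otimes>\<^sub>M lborel) (\<lambda>\<omega>. (X \<omega>, W \<omega>))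
      (\<lambda>(x, w). ennreal (BH_density v x) * ennreal (beta2_density c d w))"
    using X W unfolding c_def d_def
    by (intro distributed_joint_indep) (auto intro: lborel.sigma_finite_measure_axioms)
  \<comment> \<open>By \<open>beta2_density_eq\<close>, \<open>h x\<close> is the density of
    \<open>1 / (1 + x * W)\<close> on the unit interval.\<close>
  define h where "h x y = 1 / Beta c d * x powr d * (1 - y) powr (c - 1) * y powr (d - 1)
      * (1 - y * (1 - x)) powr - (c + d)" for x y :: real
  have h_nonneg: "h x y \<ge> 0" for x y
    using B by (simp add: h_def)
  have [measurable]: "(\<lambda>(x, y). h x y) \<in> borel_measurable (lborel \<Otimes>\<^sub>M lborel)"
    unfolding h_def by measurable
  have inner_w: "(\<integral>\<^sup>+w. ennreal (beta2_density c d w) * indicator A (1 / (1 + x * w)) \<partial>lborel)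
      = (\<integral>\<^sup>+y. indicator ({0<..<1} \<inter> A) y * ennreal (h x y) \<partial>lborel)"
    if x: "x \<in> {0<..<1}" and [measurable]: "A \<in> sets borel" for x A
  proof -
    have hx [measurable]: "h x \<in> borel_measurable borel"
      unfolding h_def by measurable
    have "(\<integral>\<^sup>+w. ennreal (beta2_density c d w) * indicator A (1 / (1 + x * w)) \<partial>lborel)
        = (\<integral>\<^sup>+w. ennreal (x / (1 + x * w)\<^sup>2 * indicator {0<..} w)
             * (indicator A (1 / (1 + x * w)) * ennreal (h x (1 / (1 + x * w)))) \<partial>lborel)"
    proof (intro nn_integral_cong)
      fix w :: real
      show "ennreal (beta2_density c d w) * indicator A (1 / (1 + x * w))
          = ennreal (x / (1 + x * w)\<^sup>2 * indicator {0<..} w)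
             * (indicator A (1 / (1 + x * w)) * ennreal (h x (1 / (1 + x * w))))"
      proof (cases "w > 0")
        case True
        then have "beta2_density c d w = x / (1 + x * w)\<^sup>2 * h x (1 / (1 + x * w))"
          using x unfolding h_def by (intro beta2_density_eq) auto
        then have "ennreal (beta2_density c d w)
            = ennreal (x / (1 + x * w)\<^sup>2) * ennreal (h x (1 / (1 + x * w)))"
          using x by (simp only:) (intro ennreal_mult h_nonneg, auto)
        then show ?thesis
          using True by (simp add: mult_ac)
      qed (simp add: beta2_density_def)
    qed
    also have "\<dots> = (\<integral>\<^sup>+y. indicator {0<..<1} y * (indicator A y * ennreal (h x y)) \<partial>lborel)"
      using x by (intro nn_integral_one_over_one_plus_mult) auto
    also have "\<dots> = (\<integral>\<^sup>+y. indicator ({0<..<1} \<inter> A) y * ennreal (h x y) \<partial>lborel)"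
      by (intro nn_integral_cong) (auto simp: indicator_def)
    finally show ?thesis .
  qed
  have inner_x: "(\<integral>\<^sup>+x. ennreal (BH_density v x) * ennreal (h x y) \<partial>lborel) = ennreal (K * BH_kernel u y)"
    if y: "y \<in> {0<..<1}" for y
  proof -
    let ?k = "\<lambda>x. x powr (r - 1) * (1 - x) powr (b - 1) * hyp2F1 p q r x * indicator {0<..<1} x
        * (1 - y * (1 - x)) powr - (r + b - p)"
    let ?e = "(1 - y) powr (c - 1) * y powr (d - 1) / (C * Beta c d)"
    have "BH_density v x * h x y = ?e * ?k x" for x
    proof (cases "x \<in> {0<..<1}")
      case True
      \<comment> \<open>The choice \<open>d = r - a\<close> raises the exponent to
        \<open>r - 1\<close>, which matches the lower parameter \<open>r\<close>; likewise
        \<open>c + d = r + b - p\<close> is the exponent required by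
        \<open>nn_integral_hyp2F1_powr\<close>.\<close>
      have "x powr (a - 1) * x powr d = x powr (r - 1)"
        by (simp add: d_def flip: powr_add)
      then show ?thesis
        unfolding cd(3)[symmetric] BH_density_def C_def[symmetric]
        using True by (simp add: BH_kernel_def h_def v_def vector_5 mult_ac)
    qed (simp add: BH_density_def BH_kernel_def)
    then have "(\<integral>\<^sup>+x. ennreal (BH_density v x) * ennreal (h x y) \<partial>lborel)
        = (\<integral>\<^sup>+x. ennreal ?e * ennreal (?k x) \<partial>lborel)"
      using X_nonneg h_nonneg C B by (intro nn_integral_cong) (simp flip: ennreal_mult ennreal_mult')
    also have "\<dots> = ennreal ?e * (\<integral>\<^sup>+x. ennreal (?k x) \<partial>lborel)"
      by (rule nn_integral_cmult) measurable
    also have "(\<integral>\<^sup>+x. ennreal (?k x) \<partial>lborel) = ennreal (J * hyp2F1 (r + b - p - q) b (r + b - q) y)"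
      unfolding J_def using ab cd q y F_pos by (intro nn_integral_hyp2F1_powr) auto
    also have "ennreal ?e * \<dots> = ennreal (?e * (J * hyp2F1 (r + b - p - q) b (r + b - q) y))"
      using C B by (subst ennreal_mult') auto
    also have "?e * (J * hyp2F1 (r + b - p - q) b (r + b - q) y) = K * BH_kernel u y"
      using y by (simp add: K_def BH_kernel_def u_def vector_5 c_def d_def)
    finally show ?thesis .
  qed
  have "distributed M lborel (\<lambda>\<omega>. 1 / (1 + X \<omega> * W \<omega>)) (\<lambda>y. ennreal (K * BH_kernel u y))"
    unfolding distributed_def
  proof (intro conjI measure_eqI)
    fix A assume "A \<in> sets (distr M lborel (\<lambda>\<omega>. 1 / (1 + X \<omega> * W \<omega>)))"
    then have [measurable]: "A \<in> sets borel"
      by simp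
    have "emeasure (distr M lborel (\<lambda>\<omega>. 1 / (1 + X \<omega> * W \<omega>))) A
        = (\<integral>\<^sup>+y. indicator A y \<partial>distr M lborel (\<lambda>\<omega>. 1 / (1 + X \<omega> * W \<omega>)))"
      by simp
    also have "\<dots> = (\<integral>\<^sup>+\<omega>. indicator A (1 / (1 + X \<omega> * W \<omega>)) \<partial>M)"
      by (subst nn_integral_distr) auto
    also have "\<dots> = (\<integral>\<^sup>+\<omega>. (\<lambda>(x, w). indicator A (1 / (1 + x * w))) (X \<omega>, W \<omega>) \<partial>M)"
      by simp
    also have "\<dots> = (\<integral>\<^sup>+z. (\<lambda>(x, w). ennreal (BH_density v x) * ennreal (beta2_density c d w)) z
        * (\<lambda>(x, w). indicator A (1 / (1 + x * w))) z \<partial>(lborel \<Otimes>\<^sub>M lborel))"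
      by (rule distributed_nn_integral[OF XW, symmetric]) measurable
    also have "\<dots> = (\<integral>\<^sup>+x. \<integral>\<^sup>+w. ennreal (BH_density v x) * ennreal (beta2_density c d w)
        * indicator A (1 / (1 + x * w)) \<partial>lborel \<partial>lborel)"
      by (subst lborel.nn_integral_fst[symmetric]) auto
    also have "\<dots> = (\<integral>\<^sup>+x. \<integral>\<^sup>+y. ennreal (BH_density v x) * (indicator ({0<..<1} \<inter> A) y * ennreal (h x y)) \<partial>lborel \<partial>lborel)"
    proof (rule nn_integral_cong)
      fix x :: real
      have "(\<integral>\<^sup>+w. ennreal (BH_density v x) * ennreal (beta2_density c d w) * indicator A (1 / (1 + x * w)) \<partial>lborel)
          = ennreal (BH_density v x) * (\<integral>\<^sup>+w. ennreal (beta2_density c d w) * indicator A (1 / (1 + x * w)) \<partial>lborel)"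
        unfolding mult.assoc by (rule nn_integral_cmult) measurable
      \<comment> \<open>Outside the unit interval, where \<open>inner_w\<close> does not apply, the
        density of \<open>X\<close> is 0.\<close>
      also have "\<dots> = ennreal (BH_density v x) * (\<integral>\<^sup>+y. indicator ({0<..<1} \<inter> A) y * ennreal (h x y) \<partial>lborel)"
        by (cases "x \<in> {0<..<1}") (simp_all add: inner_w BH_density_def BH_kernel_def)
      also have "\<dots> = (\<integral>\<^sup>+y. ennreal (BH_density v x) * (indicator ({0<..<1} \<inter> A) y * ennreal (h x y)) \<partial>lborel)"
        by (rule nn_integral_cmult[symmetric]) (simp add: h_def)
      finally show "(\<integral>\<^sup>+w. ennreal (BH_density v x) * ennreal (beta2_density c d w) * indicator A (1 / (1 + x * w)) \<partial>lborel)
          = (\<integral>\<^sup>+y. ennreal (BH_density v x) * (indicator ({0<..<1} \<inter> A) y * ennreal (h x y)) \<partial>lborel)" .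
    qed
    also have "\<dots> = (\<integral>\<^sup>+y. \<integral>\<^sup>+x. ennreal (BH_density v x) * (indicator ({0<..<1} \<inter> A) y * ennreal (h x y)) \<partial>lborel \<partial>lborel)"
      by (rule lborel_pair.Fubini'[symmetric]) measurable
    also have "\<dots> = (\<integral>\<^sup>+y. ennreal (K * BH_kernel u y) * indicator A y \<partial>lborel)"
    proof (rule nn_integral_cong)
      fix y :: real
      show "(\<integral>\<^sup>+x. ennreal (BH_density v x) * (indicator ({0<..<1} \<inter> A) y * ennreal (h x y)) \<partial>lborel)
          = ennreal (K * BH_kernel u y) * indicator A y"
      proof (cases "y \<in> {0<..<1} \<inter> A")
        case False
        then show ?thesis
          by (auto simp: BH_kernel_def indicator_def)
      qed (simp add: inner_x)
    qed
    also have "\<dots> = emeasure (density lborel (\<lambda>y. ennreal (K * BH_kernel u y))) A"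
      by (subst emeasure_density) auto
    finally show "emeasure (distr M lborel (\<lambda>\<omega>. 1 / (1 + X \<omega> * W \<omega>))) A
        = emeasure (density lborel (\<lambda>y. ennreal (K * BH_kernel u y))) A" .
  qed auto
  then show ?thesis
    unfolding BH_density_def using BH_kernel_nonneg[OF u] K
    by (intro distributed_normalize[of _ K]) auto
qed

text \<open>The sign of \<open>r + b - q\<close> is read off the recurrence at \<open>c = b\<close>,
  all of whose other factors are positive. The upper parameters \<open>r + b - p - q\<close> and
  \<open>b\<close> of the new series are positive as well, and so is every term.\<close>

lemma BH_params_shift:
  assumes v: "vector [a, b, p, q, r] \<in> BH_params" and p: "a + b - p > 0" and a: "r - a > 0"
  shows "r + b - q > 0"
    and "vector [r - a, a + b - p, r + b - p - q, b, r + b - q] \<in> BH_params"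
proof -
  have ab: "a > 0" "b > 0" "r > 0" "r + b - p - q > 0" and F_pos: "\<And>x. x \<in> {0<..<1} \<Longrightarrow> hyp2F1 p q r x > 0"
    using v a by (auto simp: BH_params_def vector_5)
  let ?J = "\<lambda>c. Beta r c * hyp2F1 p q (r + c) 1"
  have J: "?J c > 0" if "c \<ge> b" for c
    by (rule hyp2F1_Beta_integral_pos) (use ab F_pos that in auto)
  have "(r + b - p) * (r + b - q) * ?J (b + 1) = b * (r + b - p - q) * ?J b"
    using ab by (intro hyp2F1_Beta_integral_plus1) auto
  also have "\<dots> > 0"
    using ab J[of b] by simp
  finally have "0 < (r + b - q) * ((r + b - p) * ?J (b + 1))"
    by (simp only: mult_ac)
  \<comment> \<open>Here \<open>r + b - p\<close> is the sum of \<open>a + b - p\<close> and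
    \<open>r - a\<close>.\<close>
  moreover have "(r + b - p) * ?J (b + 1) > 0"
    using p a by (intro mult_pos_pos[OF _ J]) auto
  ultimately show q: "r + b - q > 0"
    using zero_less_mult_pos2 by blast
  have "hyp2F1 (r + b - p - q) b (r + b - q) y > 0" if y: "y \<in> {0<..<1}" for y
    unfolding hyp2F1_altdef
  proof (rule suminf_pos)
    show "summable (\<lambda>n. hyp_coeff (r + b - p - q) b (r + b - q) n * y ^ n)"
      by (rule summable_norm_cancel[OF summable_hyp2F1]) (use y q in auto)
  qed (use y q ab in \<open>auto intro!: mult_pos_pos hyp_coeff_pos\<close>)
  \<comment> \<open>The last membership condition, on the sum of the parameters, reduces to
    \<open>a > 0\<close>.\<close>
  then show "vector [r - a, a + b - p, r + b - p - q, b, r + b - q] \<in> BH_params"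
    using p a q ab by (auto simp: BH_params_def vector_5 elim!: nonpos_Ints_cases')
qed

theorem theorem3p2:
  fixes a b p q r :: real and v :: "real^5"
  assumes v: "v = vector [a, b, p, q, r]"
    and "v \<in> BH_params"
    and "a + b - p > 0"
    and "r - a > 0"
  shows "M_mat *v v = vector [r - a, a + b - p, r + b - p - q, b, r + b - q] \<and>
    Pi_mat *v v = vector [a + b - p, r - a] \<and>
    M_mat *v v \<in> BH_params \<and>
    (\<forall>(\<Omega> :: 'a measure) X W.
       prob_space \<Omega> \<longrightarrow>
       distributed \<Omega> lborel X (BH_density v) \<longrightarrow>
       distributed \<Omega> lborel W (beta2_density ((Pi_mat *v v) $ 1) ((Pi_mat *v v) $ 2)) \<longrightarrow>
       prob_space.indep_var \<Omega> borel X borel W \<longrightarrow>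
       distributed \<Omega> lborel (\<lambda>\<omega>. 1 / (1 + X \<omega> * W \<omega>)) (BH_density (M_mat *v v)))"
proof -
  note shift = BH_params_shift[OF assms(2)[unfolded v] assms(3,4)]
  have "distributed \<Omega> lborel (\<lambda>\<omega>. 1 / (1 + X \<omega> * W \<omega>))
      (BH_density (vector [r - a, a + b - p, r + b - p - q, b, r + b - q]))"
    if "prob_space \<Omega>" "distributed \<Omega> lborel X (BH_density (vector [a, b, p, q, r]))"
      "distributed \<Omega> lborel W (beta2_density (a + b - p) (r - a))"
      "prob_space.indep_var \<Omega> borel X borel W"
    for \<Omega> :: "'a measure" and X W
    using that assms shift by (intro prob_space.distributed_one_over_one_plus_mult) auto
  then show ?thesis
    using shift(2) unfolding v M_mat_mult Pi_mat_mult by simp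
qed

end
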